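(* The Linear Extension Operator $Z$ satisfies both of the following conditions: (A) $ZV\subset V$; (B) $Zv\le v$ for all $v\in V$.
   Context: Consider an infinite horizon Markov decision process with finite state set $S$, a finite (nonempty) set of actions $A(i)$ for each $i\in S$, real immediate rewards $r(i,a)$ for $i\in S$, $a\in A(i)$, transition probabilities $p_{ij}(a)$ for $i,j\in S$, $a\in A(i)$ (so $p_{ij}(a)\ge 0$ and $\sum_{j\in S}p_{ij}(a)=1$), and discount factor $\lambda$ with $0\le\lambda<1$. Inequalities between vectors in $\mathbb{R}^{|S|}$ are component-wise. The operator $T:\mathbb{R}^{|S|}\to\mathbb{R}^{|S|}$ is $$(Tv)_i=\max_{a\in A(i)}\Bigl\{r(i,a)+\lambda\sum_{j\in S}p_{ij}(a)v_j\Bigr\},\quad i\in S,$$ and $V=\{v\in\mathbb{R}^{|S|}\mid v\ge Tv\}$. Linear Extension Operator: for $v\in V$, $Zv=v+\alpha^*(u-v)$, where $u=Tv$ and $\alpha^*\in\mathbb{R}$ is the optimal solution of the one-variable optimization problem $$\min\Bigl\{\sum_{i\in S}v_i+\alpha\sum_{i\in S}(u_i-v_i)\;\Big|\;\alpha\in\mathbb{R},\ T(v+\alpha(u-v))\le v+\alpha(u-v)\Bigr\}.$$ *)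

theory Defs
  imports "HOL-Analysis.Analysis"
begin

text \<open>
  A Markov decision process with state set the finite type \<open>'s\<close> and actions \<open>A i\<close> in state \<open>i\<close>;
  \<open>r i a\<close> is the immediate reward, \<open>p i j a\<close> the transition probability from \<open>i\<close> to \<open>j\<close> under
  action \<open>a\<close>, and \<open>l\<close> the discount factor. The order on \<open>real ^ 's\<close> is the component-wise one.
\<close>

definition is_discounted_mdp ::
  "('s::finite \<Rightarrow> 'a set) \<Rightarrow> ('s \<Rightarrow> 's \<Rightarrow> 'a \<Rightarrow> real) \<Rightarrow> real \<Rightarrow> bool" where
  "is_discounted_mdp A p l \<longleftrightarrow>
     (\<forall>i. finite (A i) \<and> A i \<noteq> {}) \<and>
     (\<forall>i. \<forall>a\<in>A i. (\<forall>j. 0 \<le> p i j a) \<and> (\<Sum>j\<in>UNIV. p i j a) = 1) \<and>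
     0 \<le> l \<and> l < 1"

definition bellman_op ::
  "('s::finite \<Rightarrow> 'a set) \<Rightarrow> ('s \<Rightarrow> 'a \<Rightarrow> real) \<Rightarrow> ('s \<Rightarrow> 's \<Rightarrow> 'a \<Rightarrow> real) \<Rightarrow> real
     \<Rightarrow> real ^ 's \<Rightarrow> real ^ 's" where
  "bellman_op A r p l v = (\<chi> i. Max ((\<lambda>a. r i a + l * (\<Sum>j\<in>UNIV. p i j a * v $ j)) ` A i))"

definition upper_set ::
  "('s::finite \<Rightarrow> 'a set) \<Rightarrow> ('s \<Rightarrow> 'a \<Rightarrow> real) \<Rightarrow> ('s \<Rightarrow> 's \<Rightarrow> 'a \<Rightarrow> real) \<Rightarrow> real
     \<Rightarrow> (real ^ 's) set" where
  "upper_set A r p l = {v. v \<ge> bellman_op A r p l v}"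

text \<open>
  For \<open>v\<close> in \<open>upper_set\<close> that is not a fixed point the minimizer is unique. If \<open>u = v\<close>, every
  real \<open>\<alpha>\<close> is a minimizer; \<open>arg_min\<close> picks an unspecified one, and \<open>linear_extension\<close> then has
  the value \<open>v\<close> whichever it is.
\<close>

definition optimal_step ::
  "('s::finite \<Rightarrow> 'a set) \<Rightarrow> ('s \<Rightarrow> 'a \<Rightarrow> real) \<Rightarrow> ('s \<Rightarrow> 's \<Rightarrow> 'a \<Rightarrow> real) \<Rightarrow> real
     \<Rightarrow> real ^ 's \<Rightarrow> real" where
  "optimal_step A r p l v =
     (let u = bellman_op A r p l v in
      arg_min (\<lambda>\<alpha>. (\<Sum>i\<in>UNIV. v $ i) + \<alpha> * (\<Sum>i\<in>UNIV. u $ i - v $ i))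
        (\<lambda>\<alpha>. bellman_op A r p l (v + \<alpha> *\<^sub>R (u - v)) \<le> v + \<alpha> *\<^sub>R (u - v)))"

definition linear_extension ::
  "('s::finite \<Rightarrow> 'a set) \<Rightarrow> ('s \<Rightarrow> 'a \<Rightarrow> real) \<Rightarrow> ('s \<Rightarrow> 's \<Rightarrow> 'a \<Rightarrow> real) \<Rightarrow> real
     \<Rightarrow> real ^ 's \<Rightarrow> real ^ 's" where
  "linear_extension A r p l v =
     v + optimal_step A r p l v *\<^sub>R (bellman_op A r p l v - v)"

end

theory Submission
  imports Defs
begin

text \<open>
  Unless \<open>v\<close> is a fixed point of the Bellman operator \<open>T\<close>, so that the extension does not move it,
  both claims follow once the minimum defining the step is known to be attained: the minimizer
  \<open>\<alpha>\<close> is feasible, which says exactly that \<open>v + \<alpha>(Tv - v)\<close> lies in \<open>V\<close>; and the step \<open>0\<close> is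
  feasible as well, so optimality together with \<open>\<Sum>\<^sub>i (Tv - v)\<^sub>i < 0\<close> forces \<open>\<alpha> \<ge> 0\<close>, whence
  \<open>v + \<alpha>(Tv - v) \<le> v\<close>.

  The objective is a strictly decreasing function of the step, so attainment means that the feasible
  steps have a greatest element. The set \<open>V\<close> is cut out by finitely many non-strict linear
  inequalities and is therefore closed (\<open>closed_upper_set\<close>); discounting bounds it from below
  (\<open>upper_set_bounded_below\<close>), while some component of \<open>v + \<alpha>(Tv - v)\<close> tends to minus infinity as
  \<open>\<alpha>\<close> grows. So the feasible steps form a nonempty closed set of reals that is bounded above.
\<close>

text \<open>
  Replacing the maximum over actions by one inequality per action makes \<open>upper_set\<close> a polyhedron.
\<close>

lemma mem_upper_set_iff:
  assumes "is_discounted_mdp A p l"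
  shows "w \<in> upper_set A r p l \<longleftrightarrow>
    (\<forall>i. \<forall>a\<in>A i. r i a + l * (\<Sum>j\<in>UNIV. p i j a * w $ j) \<le> w $ i)"
  using assms
  by (auto simp: upper_set_def bellman_op_def less_eq_vec_def is_discounted_mdp_def)

lemma closed_upper_set:
  assumes "is_discounted_mdp A p l"
  shows "closed (upper_set A r p l)"
proof -
  have "upper_set A r p l =
      (\<Inter>i. \<Inter>a\<in>A i. {w. r i a + l * (\<Sum>j\<in>UNIV. p i j a * w $ j) \<le> w $ i})"
    by (auto simp: mem_upper_set_iff[OF assms])
  also have "closed \<dots>"
    by (intro closed_INT ballI closed_Collect_le continuous_intros)
  finally show ?thesis .
qed

text \<open>
  At a state where \<open>w\<close> is smallest, with value \<open>m\<close>, the expected continuation value is at least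
  \<open>m\<close>; hence \<open>m \<ge> c + l m\<close> for any lower bound \<open>c\<close> on the rewards, that is, \<open>m \<ge> c / (1 - l)\<close>.
\<close>

lemma upper_set_bounded_below:
  assumes mdp: "is_discounted_mdp A p l"
  obtains b where "\<And>w i. w \<in> upper_set A r p l \<Longrightarrow> b \<le> w $ i"
proof -
  have l: "0 \<le> l" "l < 1" and fin: "finite (\<Union>i. (\<lambda>a. r i a) ` A i)"
    using mdp by (auto simp: is_discounted_mdp_def)
  define c where "c = Min (\<Union>i. (\<lambda>a. r i a) ` A i)"
  have c: "c \<le> r i a" if "a \<in> A i" for i a
    unfolding c_def using that by (intro Min_le[OF fin]) auto
  show thesis
  proof
    fix w i assume w: "w \<in> upper_set A r p l"
    obtain k where k: "\<And>j. w $ k \<le> w $ j"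
      using ex_is_arg_min_if_finite[of UNIV "\<lambda>j. w $ j"] by (auto simp: is_arg_min_linorder)
    obtain a where a: "a \<in> A k" using mdp by (fastforce simp: is_discounted_mdp_def)
    have p: "\<And>j. 0 \<le> p k j a" "(\<Sum>j\<in>UNIV. p k j a) = 1"
      using mdp a by (auto simp: is_discounted_mdp_def)
    have "w $ k = (\<Sum>j\<in>UNIV. p k j a * w $ k)"
      by (simp add: p(2) flip: sum_distrib_right)
    also have "\<dots> \<le> (\<Sum>j\<in>UNIV. p k j a * w $ j)"
      by (intro sum_mono mult_left_mono k p)
    finally have "c + l * w $ k \<le> r k a + l * (\<Sum>j\<in>UNIV. p k j a * w $ j)"
      using c[OF a] l by (intro add_mono mult_left_mono)
    also have "\<dots> \<le> w $ k"
      using w a by (simp add: mem_upper_set_iff[OF mdp])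
    finally have "c / (1 - l) \<le> w $ k"
      using l by (simp add: field_simps)
    then show "c / (1 - l) \<le> w $ i"
      using k[of i] by linarith
  qed
qed

text \<open>
  \<open>arg_min\<close> is an arbitrary value when no minimizer exists, so its optimality rests on exhibiting
  one: the greatest feasible step.
\<close>

lemma optimal_step_is_arg_min:
  fixes v :: "real ^ 's::finite"
  assumes mdp: "is_discounted_mdp A p l" and v: "v \<in> upper_set A r p l"
    and neq: "bellman_op A r p l v \<noteq> v"
  defines "d \<equiv> bellman_op A r p l v - v"
  shows "(\<Sum>i\<in>UNIV. d $ i) < 0"
    and "is_arg_min (\<lambda>\<alpha>. (\<Sum>i\<in>UNIV. v $ i) + \<alpha> * (\<Sum>i\<in>UNIV. d $ i))
      (\<lambda>\<alpha>. v + \<alpha> *\<^sub>R d \<in> upper_set A r p l) (optimal_step A r p l v)"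
      (is "is_arg_min ?f ?F _")
proof -
  have d_le: "d $ i \<le> 0" for i
    using v by (simp add: d_def upper_set_def less_eq_vec_def)
  obtain k where k: "d $ k < 0"
    using neq d_le by (force simp: d_def vec_eq_iff less_le)
  show sum_neg: "(\<Sum>i\<in>UNIV. d $ i) < 0"
    using sum_strict_mono_ex1[of UNIV "\<lambda>i. d $ i" "\<lambda>_. 0"] d_le k by auto
  let ?S = "{\<alpha>. ?F \<alpha>}"
  obtain b where b: "\<And>w i. w \<in> upper_set A r p l \<Longrightarrow> b \<le> w $ i"
    using upper_set_bounded_below[OF mdp] by blast
  have "\<alpha> \<le> (v $ k - b) / - d $ k" if "\<alpha> \<in> ?S" for \<alpha>
    using b[of "v + \<alpha> *\<^sub>R d" k] that k by (simp add: field_simps)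
  then have bdd: "bdd_above ?S" by (rule bdd_aboveI)
  have "closed ((\<lambda>\<alpha>. v + \<alpha> *\<^sub>R d) -` upper_set A r p l)"
    by (intro continuous_closed_vimage closed_upper_set[OF mdp] continuous_intros)
  then have "closed ?S" by (simp add: vimage_def)
  moreover have "?S \<noteq> {}" using v by (auto intro!: exI[of _ 0])
  ultimately have "Sup ?S \<in> ?S" using bdd by (intro closed_contains_Sup)
  moreover have "\<alpha> \<le> Sup ?S" if "?F \<alpha>" for \<alpha> using that bdd by (auto intro: cSup_upper)
  ultimately have "is_arg_min ?f ?F (Sup ?S)"
    using sum_neg by (auto simp: is_arg_min_linorder intro: mult_right_mono_neg)
  then have "is_arg_min ?f ?F (arg_min ?f ?F)"
    unfolding arg_min_def by (rule someI)
  then show "is_arg_min ?f ?F (optimal_step A r p l v)"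
    by (simp add: optimal_step_def upper_set_def d_def Let_def)
qed

theorem theorem2p2:
  fixes A :: "'s::finite \<Rightarrow> 'a set"
    and r :: "'s \<Rightarrow> 'a \<Rightarrow> real"
    and p :: "'s \<Rightarrow> 's \<Rightarrow> 'a \<Rightarrow> real"
    and l :: real
  assumes "is_discounted_mdp A p l"
  shows "linear_extension A r p l ` upper_set A r p l \<subseteq> upper_set A r p l
    \<and> (\<forall>v\<in>upper_set A r p l. linear_extension A r p l v \<le> v)"
proof -
  have "linear_extension A r p l v \<in> upper_set A r p l \<and> linear_extension A r p l v \<le> v"
    if v: "v \<in> upper_set A r p l" for v
  proof (cases "bellman_op A r p l v = v")
    case True
    then show ?thesis using v by (simp add: linear_extension_def)
  next
    case False
    let ?d = "bellman_op A r p l v - v" and ?\<alpha> = "optimal_step A r p l v"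
    have sum_neg: "(\<Sum>i\<in>UNIV. ?d $ i) < 0"
      by (rule optimal_step_is_arg_min(1)[OF assms v False])
    have feasible: "v + ?\<alpha> *\<^sub>R ?d \<in> upper_set A r p l"
      using optimal_step_is_arg_min(2)[OF assms v False] by (simp only: is_arg_min_linorder)
    have optimal: "?\<alpha> * (\<Sum>i\<in>UNIV. ?d $ i) \<le> \<beta> * (\<Sum>i\<in>UNIV. ?d $ i)"
      if "v + \<beta> *\<^sub>R ?d \<in> upper_set A r p l" for \<beta>
      using optimal_step_is_arg_min(2)[OF assms v False] that
      by (simp only: is_arg_min_linorder add_le_cancel_left)
    have "?\<alpha> * (\<Sum>i\<in>UNIV. ?d $ i) \<le> 0"
      using optimal[of 0] v by simp
    then have "0 \<le> ?\<alpha>"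
      using sum_neg by (simp only: mult_le_0_iff) linarith
    moreover have "?d $ i \<le> 0" for i
      using v by (simp add: upper_set_def less_eq_vec_def)
    ultimately have "v + ?\<alpha> *\<^sub>R ?d \<le> v"
      by (simp add: less_eq_vec_def mult_nonneg_nonpos)
    then show ?thesis
      using feasible by (simp add: linear_extension_def)
  qed
  then show ?thesis by blast
qed

end
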